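(* Let $r=r(n)\ge3$, $m=m(n)$ and $k=k(n)$ be integers with $m=o(r^{-3}n^{3/2})$ and $k=o\bigl(\frac{n^3}{r^6m^2}\bigr)$. Let $K=K(n)$ be a linear $r$-graph on $[n]$ with $k$ edges, and let $H$ be chosen uniformly at random from $\mathcal{L}_r(n,m)$. Then, as $n\to\infty$, \[ \mathbb{P}[K\subseteq H]=\frac{[m]_k}{N^k}\exp\Bigl[\frac{[r]_2^2k^2}{4n^2}+O\Bigl(\frac{r^4k}{n^2}+\min\Bigl\{\frac{r^6m^2k}{n^3},\frac{r^5mk}{n^2}\Bigr\}\Bigr)\Bigr]. \]
   Context: An $r$-graph on $[n]$ is a set of $r$-subsets of $[n]$ (edges); it is linear if any two distinct edges share at most one vertex. $\mathcal{L}_r(n,m)$ is the set of linear $r$-graphs on $[n]$ with exactly $m$ edges. $K\subseteq H$ means every edge of $K$ is an edge of $H$. $N=\binom nr$, $[x]_t=x(x-1)\cdots(x-t+1)$. *)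

theory Defs
  imports "HOL-Analysis.Analysis" "HOL-Library.Landau_Symbols"
begin

definition rgraph_on :: "nat \<Rightarrow> nat \<Rightarrow> nat set set \<Rightarrow> bool" where
  "rgraph_on r n H \<longleftrightarrow> (\<forall>e\<in>H. e \<subseteq> {1..n} \<and> card e = r)"

definition linear_hg :: "nat set set \<Rightarrow> bool" where
  "linear_hg H \<longleftrightarrow> (\<forall>e\<in>H. \<forall>f\<in>H. e \<noteq> f \<longrightarrow> card (e \<inter> f) \<le> 1)"

definition Lin :: "nat \<Rightarrow> nat \<Rightarrow> nat \<Rightarrow> nat set set set" where
  "Lin r n m = {H. rgraph_on r n H \<and> linear_hg H \<and> card H = m}"

definition prob_contained :: "nat \<Rightarrow> nat \<Rightarrow> nat \<Rightarrow> nat set set \<Rightarrow> real" where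
  "prob_contained r n m K = real (card {H \<in> Lin r n m. K \<subseteq> H}) / real (card (Lin r n m))"

definition ffall :: "real \<Rightarrow> nat \<Rightarrow> real" where
  "ffall x t = (\<Prod>i<t. x - real i)"

end

theory Submission
  imports Defs "HOL-Library.Ramsey"
begin

text \<open>
  Write \<open>A M F\<close> for the number of linear \<open>r\<close>-graphs with \<open>M\<close> edges that contain \<open>F\<close>, where \<open>F\<close> has
  \<open>f\<close> edges.  Double counting gives \<open>(m - f) * A m F\<close> as the sum of \<open>A m (F + g)\<close> over the edges \<open>g\<close>
  that can be added to \<open>F\<close>, and \<open>A m (F + g) = A (m - 1) F * (1 - b g)\<close>, where \<open>b g\<close> is the
  probability that a random \<open>(m - 1)\<close>-edge extension of \<open>F\<close> has an edge meeting \<open>g\<close> in at least two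
  vertices.  A first-moment bound yields \<open>A M (F + h) = (M - f) / N * A M F\<close> up to a factor
  \<open>1 + O(r^4 m / n^2)\<close>; inserting this into the first two Bonferroni inequalities shows that \<open>b g\<close>
  agrees with a quantity independent of \<open>g\<close> up to \<open>O(min (r^6 m^2 / n^3) (r^4 m / n^2))\<close>.  So the
  terms of the sum are almost equal and \<open>A m (F + g) / A m F\<close> is nearly \<open>(m - f)\<close> divided by the
  number of addable edges, which is \<open>N * (1 - f * [r]_2^2 / (2 n^2))\<close> up to the same error.
  Multiplying over the edges of \<open>K\<close> gives the theorem.
\<close>

section \<open>Cardinalities of unions\<close>

lemma card_UN_le_uniform:
  fixes c :: real
  assumes "finite I" and "\<And>i. i \<in> I \<Longrightarrow> real (card (A i)) \<le> c"
  shows "real (card (\<Union>i\<in>I. A i)) \<le> real (card I) * c"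
proof -
  have "real (card (\<Union>i\<in>I. A i)) \<le> (\<Sum>i\<in>I. real (card (A i)))"
    using of_nat_mono[OF card_UN_le[OF assms(1), of A]] by (simp only: of_nat_sum)
  also have "\<dots> \<le> real (card I) * c"
    using assms(2) by (rule sum_bounded_above)
  finally show ?thesis .
qed

lemma bonferroni_card_UN:
  assumes "finite I" and "\<And>i. i \<in> I \<Longrightarrow> finite (A i)"
  shows "(\<Sum>i\<in>I. card (A i)) \<le> card (\<Union>i\<in>I. A i) + (\<Sum>i\<in>I. \<Sum>j\<in>I - {i}. card (A i \<inter> A j))"
  using assms
proof (induction I rule: finite_induct)
  case empty
  then show ?case by simp
next
  case (insert x I)
  let ?U = "\<Union>i\<in>I. A i"
  have "finite (A x)" "finite ?U" using insert by auto
  then have "card (A x) + card ?U = card (A x \<union> ?U) + card (A x \<inter> ?U)"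
    by (rule card_Un_Int)
  moreover have "card (A x \<inter> ?U) \<le> (\<Sum>j\<in>I. card (A x \<inter> A j))"
    using card_UN_le[OF insert(1), of "\<lambda>j. A x \<inter> A j"] by (simp only: Int_UN_distrib)
  moreover have "(\<Sum>i\<in>I. \<Sum>j\<in>I - {i}. card (A i \<inter> A j))
      \<le> (\<Sum>i\<in>I. \<Sum>j\<in>insert x I - {i}. card (A i \<inter> A j))"
    using insert(1) by (intro sum_mono sum_mono2) auto
  moreover have "insert x I - {x} = I" using insert(2) by auto
  ultimately show ?case using insert by simp
qed

lemma bonferroni_card_UN_uniform:
  fixes a b :: real
  assumes fin: "finite I" "\<And>i. i \<in> I \<Longrightarrow> finite (A i)"
    and single: "\<And>i. i \<in> I \<Longrightarrow> a \<le> real (card (A i))"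
    and pair: "\<And>i j. i \<in> I \<Longrightarrow> j \<in> I \<Longrightarrow> i \<noteq> j \<Longrightarrow> real (card (A i \<inter> A j)) \<le> b"
  shows "real (card I) * a - real (card I) * (real (card I) - 1) * b \<le> real (card (\<Union>i\<in>I. A i))"
proof -
  have "real (card I) * a \<le> (\<Sum>i\<in>I. real (card (A i)))"
    using single by (rule sum_bounded_below)
  also have "\<dots> \<le> real (card (\<Union>i\<in>I. A i))
      + (\<Sum>i\<in>I. \<Sum>j\<in>I - {i}. real (card (A i \<inter> A j)))"
    using of_nat_mono[where 'a = real, OF bonferroni_card_UN[of I A, OF fin]] by simp
  also have "(\<Sum>i\<in>I. \<Sum>j\<in>I - {i}. real (card (A i \<inter> A j)))
      \<le> real (card I) * ((real (card I) - 1) * b)"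
  proof (rule sum_bounded_above)
    fix i assume "i \<in> I"
    then have "(\<Sum>j\<in>I - {i}. real (card (A i \<inter> A j))) \<le> real (card (I - {i})) * b"
      by (intro sum_bounded_above pair) auto
    also have "real (card (I - {i})) = real (card I) - 1"
      using card_Suc_Diff1[OF fin(1) \<open>i \<in> I\<close>] by linarith
    finally show "(\<Sum>j\<in>I - {i}. real (card (A i \<inter> A j))) \<le> (real (card I) - 1) * b" .
  qed
  finally show ?thesis by (simp add: mult.assoc)
qed

section \<open>Positive reals with close logarithms\<close>

definition log_close :: "real \<Rightarrow> real \<Rightarrow> real \<Rightarrow> bool" where
  "log_close \<epsilon> a b \<longleftrightarrow> (\<exists>x. \<bar>x\<bar> \<le> \<epsilon> \<and> a = b * exp x)"

lemma log_closeI: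
  assumes "0 < b" and "b * exp (- \<epsilon>) \<le> a" and "a \<le> b * exp \<epsilon>"
  shows "log_close \<epsilon> a b"
proof -
  have "0 < b * exp (- \<epsilon>)" using assms(1) by simp
  then have "0 < a" using assms(2) by linarith
  have "exp (- \<epsilon>) \<le> a / b" "a / b \<le> exp \<epsilon>"
    using assms by (simp_all add: field_simps)
  then have "- \<epsilon> \<le> ln (a / b)" "ln (a / b) \<le> \<epsilon>"
    using \<open>0 < a\<close> \<open>0 < b\<close> ln_mono[of "a / b" "exp \<epsilon>"] by (simp_all add: ln_ge_iff)
  then show ?thesis
    unfolding log_close_def using \<open>0 < a\<close> \<open>0 < b\<close> by (intro exI[of _ "ln (a / b)"]) auto
qed

lemma log_closeD:
  assumes "log_close \<epsilon> a b" and "0 \<le> b"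
  shows "b * exp (- \<epsilon>) \<le> a" and "a \<le> b * exp \<epsilon>"
  using assms by (auto simp: log_close_def abs_le_iff intro!: mult_left_mono)

lemma log_close_sym: "log_close \<epsilon> a b \<Longrightarrow> log_close \<epsilon> b a"
  unfolding log_close_def
  by (metis abs_minus_cancel exp_minus_inverse mult.assoc mult.right_neutral)

lemma log_close_trans [trans]:
  assumes "log_close \<epsilon> a b" and "log_close \<epsilon>' b c"
  shows "log_close (\<epsilon> + \<epsilon>') a c"
proof -
  obtain x y where "\<bar>x\<bar> \<le> \<epsilon>" "a = b * exp x" "\<bar>y\<bar> \<le> \<epsilon>'" "b = c * exp y"
    using assms by (auto simp: log_close_def)
  then show ?thesis
    unfolding log_close_def by (intro exI[of _ "x + y"]) (simp add: exp_add)
qed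

lemma log_close_mult_left: "log_close \<epsilon> a b \<Longrightarrow> log_close \<epsilon> (c * a) (c * b)"
  by (auto simp: log_close_def)

lemma log_close_sum:
  assumes "finite S" and "S \<noteq> {}" and "0 < c" and close: "\<And>i. i \<in> S \<Longrightarrow> log_close \<epsilon> (a i) c"
  shows "log_close \<epsilon> (\<Sum>i\<in>S. a i) (real (card S) * c)"
proof (rule log_closeI)
  have "real (card S) * (c * exp (- \<epsilon>)) \<le> (\<Sum>i\<in>S. a i)"
    using log_closeD(1)[OF close] \<open>0 < c\<close> by (intro sum_bounded_below) auto
  then show "real (card S) * c * exp (- \<epsilon>) \<le> (\<Sum>i\<in>S. a i)" by (simp add: mult.assoc)
  have "(\<Sum>i\<in>S. a i) \<le> real (card S) * (c * exp \<epsilon>)"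
    using log_closeD(2)[OF close] \<open>0 < c\<close> by (intro sum_bounded_above) auto
  then show "(\<Sum>i\<in>S. a i) \<le> real (card S) * c * exp \<epsilon>" by (simp add: mult.assoc)
qed (use assms in \<open>simp add: card_gt_0_iff\<close>)

lemma exp_le_one_minus:
  fixes x :: real
  assumes "0 \<le> x" and "x \<le> 1/2"
  shows "exp (- x - 2 * x\<^sup>2) \<le> 1 - x"
  using ln_one_minus_pos_lower_bound[OF assms] assms(2) by (subst ln_ge_iff[symmetric]) auto

lemma log_close_if_relative_error:
  assumes "0 < b" and err: "\<bar>a - b\<bar> \<le> t * b" and "t \<le> 1/2"
  shows "log_close (2 * t) a b"
proof (rule log_closeI)
  have "0 \<le> t * b" using err by linarith
  then have "0 \<le> t" using \<open>0 < b\<close> by (simp add: zero_le_mult_iff)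
  have "t * t \<le> 1/2 * t" using \<open>0 \<le> t\<close> \<open>t \<le> 1/2\<close> by (rule mult_right_mono[rotated])
  then have "exp (- (2 * t)) \<le> exp (- t - 2 * t\<^sup>2)" by (simp add: power2_eq_square)
  also have "\<dots> \<le> 1 - t" using \<open>0 \<le> t\<close> \<open>t \<le> 1/2\<close> by (rule exp_le_one_minus)
  finally have "b * exp (- (2 * t)) \<le> b * (1 - t)" using \<open>0 < b\<close> by simp
  then show "b * exp (- (2 * t)) \<le> a" using err by (simp add: algebra_simps abs_le_iff)
  have "1 + t \<le> exp (2 * t)" using exp_ge_add_one_self[of "2 * t"] \<open>0 \<le> t\<close> by linarith
  then have "b * (1 + t) \<le> b * exp (2 * t)" using \<open>0 < b\<close> by simp
  then show "a \<le> b * exp (2 * t)" using err by (simp add: algebra_simps abs_le_iff)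
qed (rule assms(1))

section \<open>Binomial coefficients and subsets of a given size\<close>

lemma of_nat_choose_le: "real (j choose s) \<le> real j ^ s / fact s"
  using of_nat_mono[where 'a = real, OF binomial_fact_pow[of j s]] by (simp add: field_simps)

lemma real_choose_two: "real (j choose 2) = real j * (real j - 1) / 2"
  by (cases j) (simp_all add: choose_two real_of_nat_div algebra_simps)

lemma choose_two_le_choose_three: "j choose 2 \<le> of_bool (2 \<le> j) + 2 * (j choose 3)"
proof (induction j)
  case (Suc j)
  have "Suc j choose 2 = (j choose 2) + j" by (simp add: numeral_2_eq_2)
  moreover have "Suc j choose 3 = (j choose 3) + (j choose 2)"
    by (simp add: numeral_2_eq_2 numeral_3_eq_3)
  moreover have "j \<le> 2 * (j choose 2)" if "2 \<le> j"
    using that by (simp add: choose_two)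
  moreover have "j choose 2 = 0" if "j < 2" using that by simp
  ultimately show ?case using Suc by (auto simp: of_bool_def split: if_splits)
qed (simp add: binomial_eq_0)

lemma choose_diff_eq_divide:
  assumes "t \<le> r" and "r \<le> n"
  shows "real ((n - t) choose (r - t)) = real (n choose r) * real (r choose t) / real (n choose t)"
proof -
  have "real (n choose r) * real (r choose t) = real (n choose t) * real ((n - t) choose (r - t))"
    by (metis assms choose_mult of_nat_mult)
  moreover have "real (n choose t) \<noteq> 0" using assms by simp
  ultimately show ?thesis by (simp add: field_simps)
qed

lemma card_nsets: "finite V \<Longrightarrow> card ([V]\<^bsup>k\<^esup>) = card V choose k"
  using n_subsets[of V k] by (simp add: nsets_def finite_subset cong: conj_cong)

lemma card_nsets_superset:
  assumes finite_V: "finite V" and S_subset: "S \<subseteq> V" "card S \<le> r"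
  shows "card {g \<in> [V]\<^bsup>r\<^esup>. S \<subseteq> g} = (card V - card S) choose (r - card S)"
proof -
  have finite_S: "finite S" using S_subset finite_V finite_subset by blast
  have "bij_betw (\<lambda>g. g - S) {g \<in> [V]\<^bsup>r\<^esup>. S \<subseteq> g} ([V - S]\<^bsup>(r - card S)\<^esup>)"
  proof (rule bij_betw_byWitness[where f' = "\<lambda>T. T \<union> S"])
    have "card (T \<union> S) = r" if "T \<in> [V - S]\<^bsup>(r - card S)\<^esup>" for T
      using that S_subset finite_S by (subst card_Un_disjoint) (auto simp: nsets_def)
    then show "(\<lambda>T. T \<union> S) ` ([V - S]\<^bsup>(r - card S)\<^esup>) \<subseteq> {g \<in> [V]\<^bsup>r\<^esup>. S \<subseteq> g}"
      using S_subset finite_S by (auto simp: nsets_def)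
  qed (use finite_S in \<open>auto simp: nsets_def card_Diff_subset\<close>)
  then have "card {g \<in> [V]\<^bsup>r\<^esup>. S \<subseteq> g} = card ([V - S]\<^bsup>(r - card S)\<^esup>)"
    by (rule bij_betw_same_card)
  also have "\<dots> = (card V - card S) choose (r - card S)"
    using finite_V S_subset finite_S by (simp add: card_nsets card_Diff_subset)
  finally show ?thesis .
qed

lemma sum_choose_card_Int:
  assumes finite_V: "finite V" and e_subset: "e \<subseteq> V" and t_le_r: "t \<le> r"
  shows "(\<Sum>g\<in>[V]\<^bsup>r\<^esup>. card (g \<inter> e) choose t) = (card e choose t) * ((card V - t) choose (r - t))"
proof -
  have fin: "finite e" "finite ([e]\<^bsup>t\<^esup>)"
    using e_subset finite_V finite_subset finite_imp_finite_nsets by blast+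
  have "(\<Sum>g\<in>[V]\<^bsup>r\<^esup>. card {S \<in> [e]\<^bsup>t\<^esup>. S \<subseteq> g}) = ((card V - t) choose (r - t)) * card ([e]\<^bsup>t\<^esup>)"
  proof (rule sum_multicount)
    show "\<forall>S\<in>[e]\<^bsup>t\<^esup>. card {g \<in> [V]\<^bsup>r\<^esup>. S \<subseteq> g} = (card V - t) choose (r - t)"
      using card_nsets_superset[OF finite_V] e_subset t_le_r by (auto simp: nsets_def)
  qed (use finite_V fin finite_imp_finite_nsets in auto)
  moreover have "card {S \<in> [e]\<^bsup>t\<^esup>. S \<subseteq> g} = card (g \<inter> e) choose t" for g
  proof -
    have "{S \<in> [e]\<^bsup>t\<^esup>. S \<subseteq> g} = [g \<inter> e]\<^bsup>t\<^esup>" by (auto simp: nsets_def)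
    then show ?thesis using fin by (simp add: card_nsets)
  qed
  ultimately show ?thesis using fin by (simp add: card_nsets mult.commute)
qed

section \<open>Linear hypergraphs and their extensions\<close>

lemma Lin_iff: "H \<in> Lin r n m \<longleftrightarrow> H \<subseteq> [{1..n}]\<^bsup>r\<^esup> \<and> linear_hg H \<and> card H = m"
  by (auto simp: Lin_def rgraph_on_def nsets_def intro: finite_subset)

lemma LinD:
  assumes "H \<in> Lin r n m"
  shows "H \<subseteq> [{1..n}]\<^bsup>r\<^esup>" "linear_hg H" "card H = m" "finite H"
  using assms finite_subset[of H "[{1..n}]\<^bsup>r\<^esup>"]
  by (simp_all add: Lin_iff finite_imp_finite_nsets)

lemma finite_Lin: "finite (Lin r n m)"
  by (rule finite_subset[of _ "Pow ([{1..n}]\<^bsup>r\<^esup>)"]) (auto simp: Lin_iff finite_imp_finite_nsets)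

lemma Lin_0: "Lin r n 0 = {{}}"
proof -
  have "H = {}" if "H \<in> Lin r n 0" for H using LinD(3,4)[OF that] by simp
  moreover have "{} \<in> Lin r n 0" by (simp add: Lin_iff linear_hg_def)
  ultimately show ?thesis by blast
qed

lemma Lin_subset:
  assumes "H \<in> Lin r n m" and "F \<subseteq> H"
  shows "F \<in> Lin r n (card F)"
  using assms unfolding Lin_iff linear_hg_def by (meson subset_iff)

lemma card_le_if_subset_Lin: "H \<in> Lin r n m \<Longrightarrow> F \<subseteq> H \<Longrightarrow> card F \<le> m"
  using card_mono LinD(3,4) by metis

locale linear_rgraphs =
  fixes n r :: nat
  assumes two_le_r: "2 \<le> r"
begin

abbreviation edges :: "nat set set" where
  "edges \<equiv> [{1..n}]\<^bsup>r\<^esup>"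

definition clash :: "nat set \<Rightarrow> nat set set" where
  "clash e = {h \<in> edges. 2 \<le> card (h \<inter> e)}"

definition addable :: "nat set set \<Rightarrow> nat set set" where
  "addable F = {g \<in> edges. \<forall>h\<in>F. card (g \<inter> h) \<le> 1}"

definition extensions :: "nat \<Rightarrow> nat set set \<Rightarrow> nat set set set" where
  "extensions M F = {H \<in> Lin r n M. F \<subseteq> H}"

definition blocked_extensions :: "nat \<Rightarrow> nat set set \<Rightarrow> nat set \<Rightarrow> nat set set set" where
  "blocked_extensions M F g = {H \<in> extensions M F. g \<notin> addable H}"

lemma finite_edges: "finite edges"
  by (simp add: finite_imp_finite_nsets)

lemma finite_clash: "finite (clash e)"
  unfolding clash_def using finite_edges by simp

lemma finite_addable: "finite (addable F)"
  unfolding addable_def using finite_edges by simp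

lemma finite_extensions: "finite (extensions M F)"
  unfolding extensions_def using finite_Lin by simp

lemma addable_subset_edges: "addable F \<subseteq> edges"
  by (auto simp: addable_def)

lemma addable_antimono: "F \<subseteq> H \<Longrightarrow> addable H \<subseteq> addable F"
  by (auto simp: addable_def)

lemma addable_eq_Diff_clash: "addable F = edges - (\<Union>h\<in>F. clash h)"
  by (auto simp: addable_def clash_def)

lemma addable_notin:
  assumes "g \<in> addable F" shows "g \<notin> F"
  using assms two_le_r by (auto simp: addable_def nsets_def dest!: bspec)

lemma insert_addable_Lin:
  assumes F_Lin: "F \<in> Lin r n f" and g_addable: "g \<in> addable F"
  shows "insert g F \<in> Lin r n (Suc f)"
proof -
  have "linear_hg (insert g F)"
    using LinD(2)[OF F_Lin] g_addable by (auto simp: linear_hg_def addable_def Int_commute)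
  then show ?thesis
    using LinD[OF F_Lin] g_addable addable_notin[OF g_addable] by (auto simp: Lin_iff addable_def)
qed

lemma addable_if_mem_Diff:
  assumes H_Lin: "H \<in> Lin r n M" and "F \<subseteq> H" and g_mem_Diff: "g \<in> H - F"
  shows "g \<in> addable F"
proof -
  have "card (g \<inter> h) \<le> 1" if "h \<in> F" for h
  proof -
    have "g \<in> H" "h \<in> H" "g \<noteq> h" using \<open>F \<subseteq> H\<close> g_mem_Diff that by auto
    then show ?thesis using LinD(2)[OF H_Lin] by (simp add: linear_hg_def)
  qed
  moreover have "g \<in> edges" using LinD(1)[OF H_Lin] g_mem_Diff by blast
  ultimately show ?thesis by (simp add: addable_def)
qed

lemma extensions_eq_empty:
  assumes "M < card F" shows "extensions M F = {}"
  using card_le_if_subset_Lin[of _ r n M F] assms by (auto simp: extensions_def)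

lemma extensions_self:
  assumes F_Lin: "F \<in> Lin r n f" shows "extensions f F = {F}"
proof -
  have "H = F" if "H \<in> Lin r n f" "F \<subseteq> H" for H
    using card_subset_eq[OF LinD(4)[OF that(1)] that(2)] LinD(3)[OF that(1)] LinD(3)[OF F_Lin]
    by simp
  then show ?thesis using F_Lin by (auto simp: extensions_def)
qed

lemma extensions_insert: "extensions M (insert g F) = {H \<in> extensions M F. g \<in> H}"
  by (auto simp: extensions_def)

lemma extensions_insert_Int:
  "extensions M (insert g F) \<inter> extensions M (insert h F) = extensions M (insert h (insert g F))"
  by (auto simp: extensions_def)

lemma extensions_insert_eq_empty:
  assumes "h \<notin> F" and "h \<notin> addable F" shows "extensions M (insert h F) = {}"
  using assms addable_if_mem_Diff by (auto simp: extensions_def)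

lemma addable_Int_extension:
  assumes "H \<in> extensions M F"
  shows "{g \<in> addable F. g \<in> H} = H - F"
proof -
  have "H \<in> Lin r n M" "F \<subseteq> H" using assms by (auto simp: extensions_def)
  then show ?thesis using addable_if_mem_Diff[of H M F] addable_notin[of _ F] by blast
qed

lemma sum_card_extensions_insert:
  assumes F_Lin: "F \<in> Lin r n f"
  shows "(\<Sum>g\<in>addable F. card (extensions M (insert g F))) = (M - f) * card (extensions M F)"
proof -
  have "card {g \<in> addable F. g \<in> H} = M - f" if H_extends: "H \<in> extensions M F" for H
  proof -
    have "H \<in> Lin r n M" "F \<subseteq> H" using H_extends by (auto simp: extensions_def)
    then have "card (H - F) = M - f"
      using LinD[OF F_Lin] LinD(3)[of H r n M] by (simp add: card_Diff_subset)
    then show ?thesis using addable_Int_extension[OF H_extends] by simp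
  qed
  then show ?thesis
    unfolding extensions_insert
    by (intro sum_multicount) (auto simp: finite_addable finite_extensions)
qed

lemma card_extensions_Suc_insert:
  assumes g_addable: "g \<in> addable F"
  shows "card (extensions (Suc M) (insert g F)) = card {H \<in> extensions M F. g \<in> addable H}"
proof -
  have "bij_betw (\<lambda>H. H - {g}) (extensions (Suc M) (insert g F))
      {H \<in> extensions M F. g \<in> addable H}"
  proof (rule bij_betw_byWitness[where f' = "insert g"])
    show "\<forall>H\<in>extensions (Suc M) (insert g F). insert g (H - {g}) = H"
      by (auto simp: extensions_def)
    show "\<forall>H\<in>{H \<in> extensions M F. g \<in> addable H}. insert g H - {g} = H"
      using addable_notin by auto
    show "(\<lambda>H. H - {g}) ` extensions (Suc M) (insert g F) \<subseteq> {H \<in> extensions M F. g \<in> addable H}"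
    proof clarify
      fix H assume "H \<in> extensions (Suc M) (insert g F)"
      then have H_Lin: "H \<in> Lin r n (Suc M)" "g \<in> H" "F \<subseteq> H" by (auto simp: extensions_def)
      have "H - {g} \<in> Lin r n M"
        using Lin_subset[OF H_Lin(1), of "H - {g}"] H_Lin(2) LinD(3)[OF H_Lin(1)] by simp
      moreover have "g \<in> addable (H - {g})"
        using H_Lin(2) by (intro addable_if_mem_Diff[OF H_Lin(1)]) auto
      ultimately show "H - {g} \<in> extensions M F \<and> g \<in> addable (H - {g})"
        using H_Lin(3) addable_notin[OF g_addable] by (auto simp: extensions_def)
    qed
    show "insert g ` {H \<in> extensions M F. g \<in> addable H} \<subseteq> extensions (Suc M) (insert g F)"
      using insert_addable_Lin by (auto simp: extensions_def)
  qed
  then show ?thesis by (rule bij_betw_same_card)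
qed

lemma card_extensions_Suc_insert_add_blocked:
  assumes g_addable: "g \<in> addable F"
  shows "card (extensions (Suc M) (insert g F)) + card (blocked_extensions M F g)
    = card (extensions M F)"
proof -
  have "extensions M F = {H \<in> extensions M F. g \<in> addable H} \<union> blocked_extensions M F g"
    by (auto simp: blocked_extensions_def)
  moreover have "{H \<in> extensions M F. g \<in> addable H} \<inter> blocked_extensions M F g = {}"
    by (auto simp: blocked_extensions_def)
  ultimately show ?thesis
    unfolding card_extensions_Suc_insert[OF g_addable]
    by (metis card_Un_disjoint finite_Un finite_extensions)
qed

lemma sum_card_addable:
  assumes F_Lin: "F \<in> Lin r n f"
  shows "(\<Sum>H\<in>extensions M F. card (addable H)) = (Suc M - f) * card (extensions (Suc M) F)"
proof -
  have "(\<Sum>H\<in>extensions M F. card (addable H))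
      = (\<Sum>H\<in>extensions M F. card {g \<in> addable F. g \<in> addable H})"
  proof (intro sum.cong refl arg_cong[where f = card])
    fix H assume "H \<in> extensions M F"
    then show "addable H = {g \<in> addable F. g \<in> addable H}"
      using addable_antimono[of F H] by (auto simp: extensions_def)
  qed
  also have "\<dots> = (\<Sum>g\<in>addable F. card (extensions (Suc M) (insert g F)))"
    by (intro sum_multicount_gen)
      (simp_all add: finite_addable finite_extensions card_extensions_Suc_insert)
  also have "\<dots> = (Suc M - f) * card (extensions (Suc M) F)"
    by (rule sum_card_extensions_insert[OF F_Lin])
  finally show ?thesis .
qed

lemma clash_Int_clash_subset:
  assumes h_edge: "h \<in> edges" and small_Int: "card (e \<inter> h) \<le> 1"
  shows "clash e \<inter> clash h \<subseteq> (\<Union>S\<in>[e]\<^bsup>2\<^esup>. \<Union>z\<in>h - e. {g \<in> edges. insert z S \<subseteq> g})"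
proof
  fix g assume g_clashes: "g \<in> clash e \<inter> clash h"
  then have "2 \<le> card (g \<inter> e)" "2 \<le> card (g \<inter> h)" by (auto simp: clash_def)
  then obtain S where S_pair: "S \<subseteq> g \<inter> e" "card S = 2" by (meson obtain_subset_with_card_n)
  then have "S \<in> [e]\<^bsup>2\<^esup>" by (auto simp: nsets_def intro: card_ge_0_finite)
  have "\<not> g \<inter> h \<subseteq> e \<inter> h"
    using card_mono[of "e \<inter> h" "g \<inter> h"] h_edge \<open>2 \<le> card (g \<inter> h)\<close> small_Int
    by (auto simp: nsets_def)
  then obtain z where "z \<in> g" "z \<in> h - e" by blast
  moreover have "g \<in> edges" using g_clashes by (simp add: clash_def)
  ultimately show "g \<in> (\<Union>S\<in>[e]\<^bsup>2\<^esup>. \<Union>z\<in>h - e. {g \<in> edges. insert z S \<subseteq> g})"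
    using \<open>S \<in> [e]\<^bsup>2\<^esup>\<close> S_pair(1) by blast
qed

lemma blocked_extensions_eq_UN:
  assumes g_addable: "g \<in> addable F"
  shows "blocked_extensions M F g = (\<Union>h\<in>clash g \<inter> addable F. extensions M (insert h F))"
proof -
  have blocked_iff: "g \<notin> addable H \<longleftrightarrow> (\<exists>h\<in>H. h \<in> clash g)" if "H \<in> extensions M F" for H
  proof -
    have "g \<in> edges" "H \<subseteq> edges"
      using g_addable that LinD(1)[of H r n M] by (simp_all add: addable_def extensions_def)
    moreover have "h \<in> clash g \<longleftrightarrow> \<not> card (g \<inter> h) \<le> 1" if "h \<in> edges" for h
      using that by (simp add: clash_def Int_commute) linarith
    ultimately show ?thesis unfolding addable_def by blast
  qed
  have addable: "h \<in> addable F" if "H \<in> extensions M F" "h \<in> H" "h \<in> clash g" for H h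
  proof -
    have "h \<notin> F" using that(3) g_addable by (auto simp: clash_def addable_def Int_commute)
    then show ?thesis using addable_Int_extension[OF that(1)] that(2) by blast
  qed
  have "H \<in> blocked_extensions M F g \<longleftrightarrow> H \<in> extensions M F \<and> (\<exists>h\<in>H. h \<in> clash g)" for H
    using blocked_iff by (auto simp: blocked_extensions_def)
  then show ?thesis
    unfolding extensions_insert using addable by blast
qed

end

section \<open>Clashing edges when \<open>r\<^sup>2 \<le> n\<close>\<close>

locale sparse_rgraphs =
  fixes n r :: nat
  assumes three_le_r: "3 \<le> r" and r_sq_le_n: "r\<^sup>2 \<le> n"

sublocale sparse_rgraphs \<subseteq> linear_rgraphs
  by unfold_locales (use three_le_r in simp)

context sparse_rgraphs
begin

definition N :: real where
  "N = real (n choose r)"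

(* N * \<delta> = (r choose 2) * ((n - 2) choose (r - 2)) counts the edges through a pair of vertices of a
   fixed edge, with multiplicity. *)
definition clash_density :: real (\<open>\<delta>\<close>) where
  "\<delta> = (real r * (real r - 1))\<^sup>2 / (2 * real n * (real n - 1))"

(* Of order r^3 * (r / n)^3: the r^3 choices of three vertices on which edges are forced to meet,
   times the proportion of edges through them. *)
definition triple_density :: real (\<open>\<rho>\<close>) where
  "\<rho> = 3 * real r ^ 6 / real n ^ 3"

lemma r_le_n: "r \<le> n"
  using r_sq_le_n by (rule power2_nat_le_imp_le)

lemma nine_le_n: "9 \<le> n"
  using r_sq_le_n three_le_r power_mono[of 3 r 2] by simp

lemma real_r_sq_le_n: "real r ^ 2 \<le> real n"
  using of_nat_mono[where 'a = real, OF r_sq_le_n] by simp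

lemma card_edges: "real (card edges) = N"
  by (simp add: N_def card_nsets)

lemma N_pos: "0 < N"
  unfolding N_def using r_le_n by simp

lemma triple_density_nonneg: "0 \<le> \<rho>"
  by (simp add: triple_density_def)

lemma clash_density_nonneg: "0 \<le> \<delta>"
  using nine_le_n by (simp add: clash_density_def)

lemma clash_density_le: "\<delta> \<le> real r ^ 4 / (2 * real n ^ 2)"
proof -
  have bounds: "3 \<le> real r" "9 \<le> real n" using three_le_r nine_le_n by simp_all
  have "3 * real n \<le> real r * real n" using bounds by (intro mult_right_mono) auto
  moreover have "(real r - 1) ^ 2 * real n = real r ^ 2 * real n - 2 * (real r * real n) + real n"
    "real r ^ 2 * (real n - 1) = real r ^ 2 * real n - real r ^ 2"
    by (simp_all add: power2_diff power2_eq_square algebra_simps)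
  ultimately have "(real r - 1) ^ 2 * real n \<le> real r ^ 2 * (real n - 1)"
    using real_r_sq_le_n bounds by linarith
  then have "(real r - 1) ^ 2 / (real n - 1) \<le> real r ^ 2 / real n"
    using bounds by (simp add: field_simps)
  then have "real r ^ 2 / (2 * real n) * ((real r - 1) ^ 2 / (real n - 1))
      \<le> real r ^ 2 / (2 * real n) * (real r ^ 2 / real n)"
    by (intro mult_left_mono) auto
  then show ?thesis
    by (simp add: clash_density_def power_mult_distrib power2_eq_square power4_eq_xxxx mult_ac)
qed

lemma clash_density_sq_le: "\<delta>\<^sup>2 \<le> \<rho>"
proof -
  have "\<delta>\<^sup>2 \<le> (real r ^ 4 / (2 * real n ^ 2))\<^sup>2"
    using clash_density_le clash_density_nonneg by (rule power_mono)
  also have "\<dots> = real r ^ 6 / (4 * real n ^ 4) * real r ^ 2"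
    by (simp add: power_divide power_mult_distrib flip: power_mult power_add)
  also have "\<dots> \<le> real r ^ 6 / (4 * real n ^ 4) * real n"
    by (intro mult_left_mono real_r_sq_le_n) auto
  also have "\<dots> = \<rho> / 12"
    using nine_le_n by (simp add: triple_density_def field_simps power4_eq_xxxx power3_eq_cube)
  also have "\<dots> \<le> \<rho>" using triple_density_nonneg by simp
  finally show ?thesis .
qed

lemma choose_pair_eq: "real (r choose 2) * real ((n - 2) choose (r - 2)) = N * \<delta>"
proof -
  have "real ((n - 2) choose (r - 2)) = N * real (r choose 2) / real (n choose 2)"
    unfolding N_def using three_le_r r_le_n by (intro choose_diff_eq_divide) auto
  then show ?thesis
    by (simp add: real_choose_two clash_density_def power2_eq_square mult_ac)
qed

lemma choose_triple_le: "real ((n - 3) choose (r - 3)) \<le> 9/2 * N * real r ^ 3 / real n ^ 3"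
proof -
  have "real ((n - 3) choose (r - 3)) = N * real (r choose 3) / real (n choose 3)"
    unfolding N_def using three_le_r r_le_n by (intro choose_diff_eq_divide) auto
  also have "\<dots> \<le> N * (real r ^ 3 / fact 3) / (real n / 3) ^ 3"
  proof (intro frac_le mult_left_mono of_nat_choose_le)
    show "(real n / 3) ^ 3 \<le> real (n choose 3)"
      using binomial_ge_n_over_k_pow_k[of 3 n, where 'a = real] nine_le_n by simp
  qed (use N_pos nine_le_n in auto)
  also have "\<dots> = 9/2 * N * real r ^ 3 / real n ^ 3"
    by (simp add: fact_numeral power_divide)
  finally show ?thesis .
qed

lemma sum_choose_card_Int_edge:
  assumes "e \<in> edges" and "t \<le> r"
  shows "(\<Sum>g\<in>edges. card (g \<inter> e) choose t) = (r choose t) * ((n - t) choose (r - t))"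
  using sum_choose_card_Int[of "{1..n}" e t r] assms by (simp add: nsets_def)

lemma card_clash_le:
  assumes "e \<in> edges"
  shows "real (card (clash e)) \<le> N * \<delta>"
proof -
  have "card (clash e) = (\<Sum>g\<in>clash e. 1)" by simp
  also have "\<dots> \<le> (\<Sum>g\<in>clash e. card (g \<inter> e) choose 2)"
    by (intro sum_mono) (simp add: clash_def Suc_le_eq)
  also have "\<dots> \<le> (\<Sum>g\<in>edges. card (g \<inter> e) choose 2)"
    by (intro sum_mono2 finite_edges) (auto simp: clash_def)
  also have "\<dots> = (r choose 2) * ((n - 2) choose (r - 2))"
    using assms two_le_r by (rule sum_choose_card_Int_edge)
  finally show ?thesis using choose_pair_eq by (metis of_nat_le_iff of_nat_mult)
qed

lemma card_clash_ge:
  assumes e_edge: "e \<in> edges"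
  shows "N * (\<delta> - \<rho>) \<le> real (card (clash e))"
proof -
  have "(r choose 2) * ((n - 2) choose (r - 2)) = (\<Sum>g\<in>edges. card (g \<inter> e) choose 2)"
    using sum_choose_card_Int_edge[OF e_edge two_le_r] by simp
  also have "\<dots> \<le> (\<Sum>g\<in>edges. of_bool (2 \<le> card (g \<inter> e)) + 2 * (card (g \<inter> e) choose 3))"
    by (intro sum_mono choose_two_le_choose_three)
  also have "\<dots> = card (clash e) + 2 * ((r choose 3) * ((n - 3) choose (r - 3)))"
    using sum_choose_card_Int_edge[OF e_edge three_le_r] finite_edges
    by (simp add: sum.distrib clash_def Int_def flip: sum_distrib_left)
  finally have "N * \<delta>
      \<le> real (card (clash e)) + 2 * (real (r choose 3) * real ((n - 3) choose (r - 3)))"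
    using choose_pair_eq by (metis of_nat_le_iff of_nat_mult of_nat_add of_nat_numeral)
  moreover have "real (r choose 3) * real ((n - 3) choose (r - 3)) \<le> N * \<rho> / 4"
  proof -
    have "real (r choose 3) * real ((n - 3) choose (r - 3))
        \<le> real r ^ 3 / fact 3 * (9/2 * N * real r ^ 3 / real n ^ 3)"
      by (intro mult_mono of_nat_choose_le choose_triple_le) auto
    also have "\<dots> = N * \<rho> / 4"
      by (simp add: triple_density_def fact_numeral flip: power_add)
    finally show ?thesis .
  qed
  moreover have "0 \<le> N * \<rho>" using N_pos triple_density_nonneg by simp
  ultimately show ?thesis by (simp add: algebra_simps)
qed

lemma card_clash_Int_clash_le:
  assumes e_edge: "e \<in> edges" and h_edge: "h \<in> edges" and small_Int: "card (e \<inter> h) \<le> 1"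
  shows "real (card (clash e \<inter> clash h)) \<le> N * \<rho>"
proof -
  let ?through = "\<lambda>S z. {g \<in> edges. insert z S \<subseteq> g}"
  have e_props: "e \<subseteq> {1..n}" "finite e" "card e = r"
    and h_props: "h \<subseteq> {1..n}" "finite h" "card h = r"
    using e_edge h_edge by (auto simp: nsets_def)
  have card_through: "card (?through S z) = (n - 3) choose (r - 3)"
    if "S \<in> [e]\<^bsup>2\<^esup>" "z \<in> h - e" for S z
  proof -
    have "card (insert z S) = 3" "insert z S \<subseteq> {1..n}"
      using that e_props h_props by (auto simp: nsets_def card_insert_if)
    then show ?thesis using card_nsets_superset[of "{1..n}" "insert z S" r] three_le_r by simp
  qed
  have "real (card (clash e \<inter> clash h)) \<le> real (card (\<Union>S\<in>[e]\<^bsup>2\<^esup>. \<Union>z\<in>h - e. ?through S z))"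
    using clash_Int_clash_subset[OF h_edge small_Int] e_props h_props finite_edges
    by (intro of_nat_mono card_mono) (auto simp: finite_imp_finite_nsets)
  also have "\<dots> \<le> real (card ([e]\<^bsup>2\<^esup>)) * (real (card (h - e)) * real ((n - 3) choose (r - 3)))"
    using e_props h_props card_through
    by (intro card_UN_le_uniform) (auto simp: finite_imp_finite_nsets)
  also have "\<dots> \<le> real r ^ 2 / fact 2 * (real r * (9/2 * N * real r ^ 3 / real n ^ 3))"
  proof (intro mult_mono choose_triple_le)
    show "real (card ([e]\<^bsup>2\<^esup>)) \<le> real r ^ 2 / fact 2"
      using of_nat_choose_le[of r 2] e_props by (simp add: card_nsets)
    show "real (card (h - e)) \<le> real r"
      using card_mono[of h "h - e"] h_props by auto
  qed auto
  also have "\<dots> = 3/4 * (N * \<rho>)"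
    by (simp add: triple_density_def fact_numeral power2_eq_square eval_nat_numeral)
  also have "\<dots> \<le> N * \<rho>" using N_pos triple_density_nonneg by simp
  finally show ?thesis .
qed

lemma card_addable_eq: "real (card (addable F)) = N - real (card (\<Union>h\<in>F. clash h))"
proof -
  have sub: "(\<Union>h\<in>F. clash h) \<subseteq> edges" by (auto simp: clash_def)
  then have "card (addable F) = card edges - card (\<Union>h\<in>F. clash h)"
    unfolding addable_eq_Diff_clash by (intro card_Diff_subset finite_subset[OF _ finite_edges])
  moreover have "card (\<Union>h\<in>F. clash h) \<le> card edges"
    using sub by (intro card_mono finite_edges)
  ultimately show ?thesis using card_edges by (simp add: of_nat_diff)
qed

lemma card_addable_le_N: "real (card (addable F)) \<le> N"
  using card_addable_eq[of F] by simp

lemma card_addable_ge: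
  assumes F_Lin: "F \<in> Lin r n f"
  shows "N * (1 - real f * \<delta>) \<le> real (card (addable F))"
proof -
  have "real (card (\<Union>h\<in>F. clash h)) \<le> real (card F) * (N * \<delta>)"
    using LinD[OF F_Lin] by (intro card_UN_le_uniform card_clash_le) auto
  then show ?thesis using LinD(3)[OF F_Lin] by (simp add: card_addable_eq algebra_simps)
qed

lemma card_addable_le:
  assumes F_Lin: "F \<in> Lin r n f"
  shows "real (card (addable F)) \<le> N * (1 - real f * \<delta> + real f ^ 2 * \<rho>)"
proof -
  have "real (card F) * (N * (\<delta> - \<rho>)) - real (card F) * (real (card F) - 1) * (N * \<rho>)
      \<le> real (card (\<Union>h\<in>F. clash h))"
  proof (rule bonferroni_card_UN_uniform)
    fix g h assume "g \<in> F" "h \<in> F" "g \<noteq> h"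
    then show "real (card (clash g \<inter> clash h)) \<le> N * \<rho>"
      using LinD(1,2)[OF F_Lin] by (intro card_clash_Int_clash_le) (auto simp: linear_hg_def)
  qed (use LinD[OF F_Lin] card_clash_ge finite_clash in auto)
  then show ?thesis
    using LinD(3)[OF F_Lin] by (simp add: card_addable_eq algebra_simps power2_eq_square)
qed

lemma card_clash_Int_addable_le:
  assumes "g \<in> edges"
  shows "real (card (clash g \<inter> addable F)) \<le> N * \<delta>"
proof -
  have "card (clash g \<inter> addable F) \<le> card (clash g)"
    by (intro card_mono finite_clash) auto
  then show ?thesis using card_clash_le[OF assms] by linarith
qed

lemma card_clash_Int_addable_ge:
  assumes F_Lin: "F \<in> Lin r n f" and g_addable: "g \<in> addable F"
  shows "N * (\<delta> - real (Suc f) * \<rho>) \<le> real (card (clash g \<inter> addable F))"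
proof -
  let ?U = "\<Union>h\<in>F. clash g \<inter> clash h"
  have "clash g \<inter> addable F = clash g - ?U"
    by (auto simp: addable_eq_Diff_clash clash_def)
  moreover have "finite ?U" using LinD(4)[OF F_Lin] finite_clash by auto
  ultimately have "card (clash g) - card ?U \<le> card (clash g \<inter> addable F)"
    using diff_card_le_card_Diff[of ?U "clash g"] by simp
  moreover have "real (card ?U) \<le> real (card F) * (N * \<rho>)"
    using LinD[OF F_Lin] g_addable
    by (intro card_UN_le_uniform card_clash_Int_clash_le) (auto simp: addable_def)
  moreover have "N * (\<delta> - \<rho>) \<le> real (card (clash g))"
    using g_addable by (intro card_clash_ge) (simp add: addable_def)
  ultimately show ?thesis using LinD(3)[OF F_Lin] by (simp add: algebra_simps)
qed

abbreviation num_ext :: "nat \<Rightarrow> nat set set \<Rightarrow> real" where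
  "num_ext M F \<equiv> real (card (extensions M F))"

abbreviation num_blocked :: "nat \<Rightarrow> nat set set \<Rightarrow> nat set \<Rightarrow> real" where
  "num_blocked M F g \<equiv> real (card (blocked_extensions M F g))"

lemma num_ext_Suc_insert:
  assumes "g \<in> addable F"
  shows "num_ext (Suc M) (insert g F) = num_ext M F - num_blocked M F g"
  using card_extensions_Suc_insert_add_blocked[OF assms, of M] by linarith

lemma sum_num_ext_insert:
  assumes "F \<in> Lin r n f"
  shows "(\<Sum>g\<in>addable F. num_ext M (insert g F)) = real (M - f) * num_ext M F"
  using arg_cong[OF sum_card_extensions_insert[OF assms, of M], of real] by simp

lemma num_ext_Suc_le:
  assumes "F \<in> Lin r n f"
  shows "real (Suc M - f) * num_ext (Suc M) F \<le> N * num_ext M F"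
proof -
  have "real (Suc M - f) * num_ext (Suc M) F = (\<Sum>g\<in>addable F. num_ext (Suc M) (insert g F))"
    using sum_num_ext_insert[OF assms] by simp
  also have "\<dots> \<le> real (card (addable F)) * num_ext M F"
    by (intro sum_bounded_above) (simp add: num_ext_Suc_insert)
  also have "\<dots> \<le> N * num_ext M F"
    using card_addable_le_N by (simp add: mult_right_mono)
  finally show ?thesis .
qed

lemma num_ext_Suc_ge:
  assumes F_Lin: "F \<in> Lin r n f"
  shows "N * (1 - real M * \<delta>) * num_ext M F \<le> real (Suc M - f) * num_ext (Suc M) F"
proof -
  have "num_ext M F * (N * (1 - real M * \<delta>)) \<le> (\<Sum>H\<in>extensions M F. real (card (addable H)))"
    by (intro sum_bounded_below card_addable_ge) (simp add: extensions_def)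
  also have "\<dots> = real (Suc M - f) * num_ext (Suc M) F"
    using arg_cong[OF sum_card_addable[OF F_Lin, of M], of real] by simp
  finally show ?thesis by (simp add: mult.commute)
qed

lemma num_ext_pos:
  assumes F_Lin: "F \<in> Lin r n f" and "real M * \<delta> < 1" and "f \<le> M"
  shows "0 < num_ext M F"
  using assms(3,2)
proof (induction rule: dec_induct)
  case base
  then show ?case using extensions_self[OF F_Lin] by simp
next
  case (step M)
  have "real M * \<delta> \<le> real (Suc M) * \<delta>"
    using clash_density_nonneg by (intro mult_right_mono) auto
  then have "real M * \<delta> < 1" using step.prems by linarith
  then have "0 < N * (1 - real M * \<delta>) * num_ext M F" using step.IH N_pos by simp
  also have "\<dots> \<le> real (Suc M - f) * num_ext (Suc M) F" by (rule num_ext_Suc_ge[OF F_Lin])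
  finally show ?case by (simp add: zero_less_mult_iff)
qed

end

section \<open>Adding one edge\<close>

locale sparse_rgraphs_edges = sparse_rgraphs +
  fixes m :: nat
  assumes m_clash_density_le: "real m * \<delta> \<le> 1/16"
begin

definition total_clash_density :: real (\<open>\<eta>\<close>) where
  "\<eta> = real m * \<delta>"

definition step_error :: real (\<open>\<beta>\<close>) where
  "\<beta> = min (real m ^ 2 * \<rho>) \<eta>"

lemma total_clash_density_bounds: "0 \<le> \<eta>" "\<eta> \<le> 1/16"
  using m_clash_density_le clash_density_nonneg by (simp_all add: total_clash_density_def)

lemma step_error_bounds: "0 \<le> \<beta>" "\<beta> \<le> \<eta>" "\<beta> \<le> real m ^ 2 * \<rho>"
  using total_clash_density_bounds triple_density_nonneg by (simp_all add: step_error_def)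

lemma total_clash_density_sq_le: "\<eta>\<^sup>2 \<le> real m ^ 2 * \<rho>"
  unfolding total_clash_density_def power_mult_distrib
  by (intro mult_left_mono clash_density_sq_le) simp

lemma total_clash_density_sq_le_step_error: "\<eta>\<^sup>2 \<le> \<beta>"
  using total_clash_density_sq_le total_clash_density_bounds mult_right_mono[of \<eta> 1 \<eta>]
  by (simp add: step_error_def power2_eq_square)

lemma mult_clash_density_le: "j \<le> m \<Longrightarrow> real j * \<delta> \<le> \<eta>"
  unfolding total_clash_density_def using clash_density_nonneg by (intro mult_right_mono) auto

lemma num_ext_insert_le:
  assumes F_Lin: "F \<in> Lin r n f" and g_addable: "g \<in> addable F" and M_le_m: "M \<le> m"
  shows "num_ext M (insert g F) \<le> (1 + 2 * \<eta>) * real (M - f) / N * num_ext M F"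
proof (cases "M \<le> f")
  case True
  then have "extensions M (insert g F) = {}"
    using LinD(3)[OF insert_addable_Lin[OF F_Lin g_addable]] by (intro extensions_eq_empty) simp
  then show ?thesis using True by simp
next
  case False
  then obtain M' where Suc_M': "M = Suc M'" by (cases M) auto
  have "1 \<le> (1 - \<eta>) * (1 + 2 * \<eta>)"
    using mult_left_mono[of "2 * \<eta>" 1 \<eta>] total_clash_density_bounds by (simp add: algebra_simps)
  also have "\<dots> \<le> (1 - real M' * \<delta>) * (1 + 2 * \<eta>)"
    using mult_clash_density_le[of M'] M_le_m Suc_M' total_clash_density_bounds
    by (intro mult_right_mono) auto
  finally have "num_ext M' F \<le> (1 - real M' * \<delta>) * (1 + 2 * \<eta>) * num_ext M' F"
    using mult_right_mono[of 1 _ "num_ext M' F"] by simp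
  also have "\<dots> = (1 + 2 * \<eta>) / N * (N * (1 - real M' * \<delta>) * num_ext M' F)"
    using N_pos by simp
  also have "\<dots> \<le> (1 + 2 * \<eta>) / N * (real (M - f) * num_ext M F)"
    unfolding Suc_M' using total_clash_density_bounds N_pos
    by (intro mult_left_mono num_ext_Suc_ge[OF F_Lin]) auto
  finally show ?thesis
    using num_ext_Suc_insert[OF g_addable, of M'] Suc_M' by (simp add: mult_ac)
qed

lemma clash_weight_le:
  assumes "g \<in> addable F"
  shows "real (card (clash g \<inter> addable F)) * ((1 + 2 * \<eta>) * real j / N)
    \<le> real j * \<delta> * (1 + 2 * \<eta>)"
proof -
  have "real (card (clash g \<inter> addable F)) \<le> N * \<delta>"
    using assms addable_subset_edges by (intro card_clash_Int_addable_le) auto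
  then have "real (card (clash g \<inter> addable F)) * ((1 + 2 * \<eta>) * real j / N)
      \<le> N * \<delta> * ((1 + 2 * \<eta>) * real j / N)"
    using total_clash_density_bounds N_pos by (intro mult_right_mono) auto
  then show ?thesis using N_pos by (simp add: mult_ac)
qed

lemma mult_clash_density_weighted_le: "j \<le> m \<Longrightarrow> real j * \<delta> * (1 + 2 * \<eta>) \<le> \<eta> * 2"
  using mult_clash_density_le total_clash_density_bounds by (intro mult_mono) auto

lemma num_blocked_le:
  assumes F_Lin: "F \<in> Lin r n f" and g_addable: "g \<in> addable F" and M_le_m: "M \<le> m"
  shows "num_blocked M F g \<le> real (M - f) * \<delta> * (1 + 2 * \<eta>) * num_ext M F"
proof -
  let ?I = "clash g \<inter> addable F" and ?q = "(1 + 2 * \<eta>) * real (M - f) / N"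
  have "num_blocked M F g \<le> real (card ?I) * (?q * num_ext M F)"
    unfolding blocked_extensions_eq_UN[OF g_addable]
    by (intro card_UN_le_uniform num_ext_insert_le[OF F_Lin _ M_le_m]) (simp_all add: finite_clash)
  also have "\<dots> = real (card ?I) * ?q * num_ext M F" by simp
  also have "\<dots> \<le> real (M - f) * \<delta> * (1 + 2 * \<eta>) * num_ext M F"
    by (intro mult_right_mono clash_weight_le[OF g_addable]) simp
  finally show ?thesis .
qed

lemma num_ext_insert_ge:
  assumes F_Lin: "F \<in> Lin r n f" and g_addable: "g \<in> addable F" and M_le_m: "M \<le> m"
  shows "(1 - 2 * \<eta>) * real (M - f) / N * num_ext M F \<le> num_ext M (insert g F)"
proof (cases "M \<le> f")
  case False
  then obtain M' where Suc_M': "M = Suc M'" by (cases M) auto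
  have "M' \<le> m" using M_le_m Suc_M' by simp
  have "num_blocked M' F g \<le> real (M' - f) * \<delta> * (1 + 2 * \<eta>) * num_ext M' F"
    by (rule num_blocked_le[OF F_Lin g_addable \<open>M' \<le> m\<close>])
  also have "\<dots> \<le> \<eta> * 2 * num_ext M' F"
    using \<open>M' \<le> m\<close> by (intro mult_right_mono mult_clash_density_weighted_le) auto
  finally have blocked: "num_blocked M' F g \<le> \<eta> * 2 * num_ext M' F" .
  have "(1 - 2 * \<eta>) * real (M - f) / N * num_ext M F
      = (1 - 2 * \<eta>) / N * (real (Suc M' - f) * num_ext (Suc M') F)"
    by (simp add: Suc_M')
  also have "\<dots> \<le> (1 - 2 * \<eta>) / N * (N * num_ext M' F)"
    using total_clash_density_bounds N_pos by (intro mult_left_mono num_ext_Suc_le[OF F_Lin]) auto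
  also have "\<dots> = (1 - 2 * \<eta>) * num_ext M' F" using N_pos by simp
  also have "\<dots> = num_ext M' F - \<eta> * 2 * num_ext M' F" by (simp add: algebra_simps)
  also have "\<dots> \<le> num_ext M (insert g F)"
    using blocked num_ext_Suc_insert[OF g_addable, of M'] Suc_M' by simp
  finally show ?thesis .
qed simp

lemma card_extensions_insert_Int_le:
  assumes F_Lin: "F \<in> Lin r n f" and g_addable: "g \<in> addable F" and h_addable: "h \<in> addable F"
    and "g \<noteq> h" and M_le_m: "M \<le> m"
  shows "real (card (extensions M (insert g F) \<inter> extensions M (insert h F)))
    \<le> ((1 + 2 * \<eta>) * real (M - f) / N)\<^sup>2 * num_ext M F"
proof (cases "h \<in> addable (insert g F)")
  case True
  let ?q = "(1 + 2 * \<eta>) * real (M - f) / N"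
  have "num_ext M (insert h (insert g F))
      \<le> (1 + 2 * \<eta>) * real (M - Suc f) / N * num_ext M (insert g F)"
    by (rule num_ext_insert_le[OF insert_addable_Lin[OF F_Lin g_addable] True M_le_m])
  also have "\<dots> \<le> ?q * num_ext M (insert g F)"
    using total_clash_density_bounds N_pos
    by (intro mult_right_mono divide_right_mono mult_left_mono) auto
  also have "\<dots> \<le> ?q * (?q * num_ext M F)"
    using total_clash_density_bounds N_pos
    by (intro mult_left_mono num_ext_insert_le[OF F_Lin g_addable M_le_m]) auto
  finally show ?thesis by (simp add: extensions_insert_Int power2_eq_square mult.assoc)
next
  case False
  have "h \<notin> insert g F" using addable_notin[OF h_addable] \<open>g \<noteq> h\<close> by simp
  then have "extensions M (insert h (insert g F)) = {}"
    using False by (rule extensions_insert_eq_empty)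
  then show ?thesis by (simp add: extensions_insert_Int)
qed

lemma clash_weight_ge:
  assumes F_Lin: "F \<in> Lin r n f" and g_addable: "g \<in> addable F" and M_bounds: "M < m" "f \<le> M"
  shows "real (M - f) * \<delta> - 2 * \<eta>\<^sup>2 - real m ^ 2 * \<rho>
    \<le> real (card (clash g \<inter> addable F)) * ((1 - 2 * \<eta>) * real (M - f) / N)"
proof -
  define p where "p = real (M - f)"
  have p_bounds: "0 \<le> p" "p * \<delta> \<le> \<eta>"
    unfolding p_def using mult_clash_density_le[of "M - f"] M_bounds by simp_all
  have "p * \<delta> * (2 * \<eta>) \<le> \<eta> * (2 * \<eta>)"
    using p_bounds total_clash_density_bounds by (intro mult_right_mono) auto
  moreover have "real (Suc f) * p * \<rho> * (1 - 2 * \<eta>) \<le> real m ^ 2 * \<rho> * 1"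
  proof (intro mult_mono)
    show "real (Suc f) * p \<le> real m ^ 2"
      unfolding p_def power2_eq_square using M_bounds by (intro mult_mono) auto
  qed (use triple_density_nonneg total_clash_density_bounds in auto)
  ultimately have "p * \<delta> - 2 * \<eta>\<^sup>2 - real m ^ 2 * \<rho> \<le> (\<delta> - real (Suc f) * \<rho>) * p * (1 - 2 * \<eta>)"
    by (simp add: algebra_simps power2_eq_square)
  also have "\<dots> = N * (\<delta> - real (Suc f) * \<rho>) * ((1 - 2 * \<eta>) * p / N)" using N_pos by simp
  also have "\<dots> \<le> real (card (clash g \<inter> addable F)) * ((1 - 2 * \<eta>) * p / N)"
    using p_bounds total_clash_density_bounds N_pos
    by (intro mult_right_mono card_clash_Int_addable_ge[OF F_Lin g_addable]) auto
  finally show ?thesis unfolding p_def .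
qed

lemma num_blocked_ge:
  assumes F_Lin: "F \<in> Lin r n f" and g_addable: "g \<in> addable F" and M_bounds: "M < m" "f \<le> M"
  shows "(real (M - f) * \<delta> - 7 * (real m ^ 2 * \<rho>)) * num_ext M F \<le> num_blocked M F g"
proof -
  let ?I = "clash g \<inter> addable F" and ?p = "real (M - f)" and ?A = "num_ext M F"
  define c where "c = real (card ?I)"
  define q\<^sub>1 where "q\<^sub>1 = (1 - 2 * \<eta>) * ?p / N"
  define q\<^sub>2 where "q\<^sub>2 = (1 + 2 * \<eta>) * ?p / N"
  have "M \<le> m" using M_bounds by simp
  have nonneg: "0 \<le> c" "0 \<le> q\<^sub>2"
    unfolding c_def q\<^sub>2_def using total_clash_density_bounds N_pos by auto
  have bonferroni: "c * (q\<^sub>1 * ?A) - c * (c - 1) * (q\<^sub>2\<^sup>2 * ?A) \<le> num_blocked M F g"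
    unfolding c_def blocked_extensions_eq_UN[OF g_addable]
  proof (rule bonferroni_card_UN_uniform)
    fix i assume "i \<in> ?I"
    then show "q\<^sub>1 * ?A \<le> num_ext M (insert i F)"
      unfolding q\<^sub>1_def by (intro num_ext_insert_ge[OF F_Lin _ \<open>M \<le> m\<close>]) simp
  next
    fix i j assume "i \<in> ?I" "j \<in> ?I" "i \<noteq> j"
    then show "real (card (extensions M (insert i F) \<inter> extensions M (insert j F))) \<le> q\<^sub>2\<^sup>2 * ?A"
      unfolding q\<^sub>2_def by (intro card_extensions_insert_Int_le[OF F_Lin _ _ _ \<open>M \<le> m\<close>]) auto
  qed (simp_all add: finite_clash finite_extensions)
  have "(?p * \<delta> - 2 * \<eta>\<^sup>2 - real m ^ 2 * \<rho>) * ?A \<le> c * q\<^sub>1 * ?A"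
    unfolding c_def q\<^sub>1_def by (intro mult_right_mono clash_weight_ge[OF assms]) simp
  moreover have "c * (c - 1) * q\<^sub>2\<^sup>2 * ?A \<le> 4 * \<eta>\<^sup>2 * ?A"
  proof (rule mult_right_mono)
    have "c * q\<^sub>2 \<le> \<eta> * 2"
      unfolding c_def q\<^sub>2_def
      using clash_weight_le[OF g_addable] mult_clash_density_weighted_le
      by (rule order_trans) (use \<open>M \<le> m\<close> in simp)
    then have "(c * q\<^sub>2)\<^sup>2 \<le> (\<eta> * 2)\<^sup>2" using nonneg by (intro power_mono) auto
    moreover have "c * (c - 1) * q\<^sub>2\<^sup>2 \<le> c * c * q\<^sub>2\<^sup>2"
      using nonneg by (intro mult_right_mono mult_left_mono) auto
    ultimately show "c * (c - 1) * q\<^sub>2\<^sup>2 \<le> 4 * \<eta>\<^sup>2"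
      by (simp add: power_mult_distrib power2_eq_square mult_ac)
  qed simp
  moreover have "(?p * \<delta> - 7 * (real m ^ 2 * \<rho>)) * ?A
      \<le> (?p * \<delta> - 2 * \<eta>\<^sup>2 - real m ^ 2 * \<rho> - 4 * \<eta>\<^sup>2) * ?A"
    using total_clash_density_sq_le by (intro mult_right_mono) (linarith, simp)
  ultimately show ?thesis using bonferroni unfolding left_diff_distrib mult.assoc by linarith
qed

lemma num_blocked_approx:
  assumes F_Lin: "F \<in> Lin r n f" and g_addable: "g \<in> addable F" and M_bounds: "M < m" "f \<le> M"
  shows "\<bar>num_blocked M F g - real (M - f) * \<delta> * num_ext M F\<bar> \<le> 7 * \<beta> * num_ext M F"
proof -
  let ?p = "real (M - f)" and ?A = "num_ext M F"
  have p_bounds: "0 \<le> ?p * \<delta>" "?p * \<delta> \<le> \<eta>"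
    using mult_clash_density_le[of "M - f"] M_bounds clash_density_nonneg by auto
  have "num_blocked M F g - ?p * \<delta> * ?A \<le> 7 * \<beta> * ?A"
  proof -
    have "?p * \<delta> * (2 * \<eta>) \<le> \<eta> * (2 * \<eta>)"
      using p_bounds total_clash_density_bounds by (intro mult_right_mono) auto
    then have "?p * \<delta> * (2 * \<eta>) \<le> 7 * \<beta>"
      using total_clash_density_sq_le_step_error step_error_bounds by (simp add: power2_eq_square)
    then have "?p * \<delta> * (2 * \<eta>) * ?A \<le> 7 * \<beta> * ?A" by (intro mult_right_mono) auto
    then show ?thesis
      using num_blocked_le[OF F_Lin g_addable, of M] M_bounds by (simp add: algebra_simps)
  qed
  moreover have "?p * \<delta> * ?A - num_blocked M F g \<le> 7 * \<beta> * ?A"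
  proof (cases "real m ^ 2 * \<rho> \<le> \<eta>")
    case True
    then show ?thesis using num_blocked_ge[OF assms] by (simp add: step_error_def algebra_simps)
  next
    case False
    have "?p * \<delta> * ?A \<le> 7 * \<eta> * ?A" using p_bounds by (intro mult_right_mono) auto
    then show ?thesis using False by (simp add: step_error_def)
  qed
  ultimately show ?thesis by linarith
qed

lemma num_ext_Suc_insert_close:
  assumes F_Lin: "F \<in> Lin r n f" and g_addable: "g \<in> addable F" and M_bounds: "M < m" "f \<le> M"
  shows "log_close (16 * \<beta>) (num_ext (Suc M) (insert g F)) ((1 - real (M - f) * \<delta>) * num_ext M F)"
proof -
  let ?c = "1 - real (M - f) * \<delta>"
  have "real M * \<delta> \<le> \<eta>" "real (M - f) * \<delta> \<le> \<eta>"
    by (rule mult_clash_density_le, use M_bounds in simp)+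
  then have "real M * \<delta> < 1" "15/16 \<le> ?c" using total_clash_density_bounds by linarith+
  then have pos: "0 < num_ext M F" "0 < ?c" using num_ext_pos[OF F_Lin _ M_bounds(2)] by auto
  have "log_close (2 * (8 * \<beta>)) (num_ext (Suc M) (insert g F)) (?c * num_ext M F)"
  proof (rule log_close_if_relative_error)
    have "\<bar>num_ext (Suc M) (insert g F) - ?c * num_ext M F\<bar> \<le> 7 * \<beta> * num_ext M F"
      using num_blocked_approx[OF assms] num_ext_Suc_insert[OF g_addable, of M]
      by (simp add: algebra_simps abs_minus_commute)
    also have "\<dots> \<le> 8 * \<beta> * ?c * num_ext M F"
      using \<open>15/16 \<le> ?c\<close> step_error_bounds(1) mult_left_mono[of "7/8" ?c "8 * \<beta>"]
      by (intro mult_right_mono) auto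
    finally show "\<bar>num_ext (Suc M) (insert g F) - ?c * num_ext M F\<bar> \<le> 8 * \<beta> * (?c * num_ext M F)"
      by (simp add: mult.assoc)
    show "0 < ?c * num_ext M F" using pos by simp
    show "8 * \<beta> \<le> 1/2" using step_error_bounds total_clash_density_bounds by linarith
  qed
  then show ?thesis by simp
qed

lemma card_addable_le_step_error:
  assumes F_Lin: "F \<in> Lin r n f" and f_le_m: "f \<le> m"
  shows "real (card (addable F)) \<le> N * (1 - real f * \<delta> + \<beta>)"
proof -
  have "real f ^ 2 * \<rho> \<le> real m ^ 2 * \<rho>"
    using f_le_m triple_density_nonneg by (intro mult_right_mono power_mono) auto
  then have "N * (1 - real f * \<delta> + real f ^ 2 * \<rho>) \<le> N * (1 - real f * \<delta> + real m ^ 2 * \<rho>)"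
    using N_pos by simp
  with card_addable_le[OF F_Lin]
  have "real (card (addable F)) \<le> N * (1 - real f * \<delta> + real m ^ 2 * \<rho>)"
    by (rule order_trans)
  moreover have "N * 1 \<le> N * (1 - real f * \<delta> + \<eta>)"
    using mult_clash_density_le[OF f_le_m] N_pos by (intro mult_left_mono) auto
  with card_addable_le_N[of F] have "real (card (addable F)) \<le> N * (1 - real f * \<delta> + \<eta>)"
    by linarith
  ultimately show ?thesis by (simp add: step_error_def min_def)
qed

lemma card_addable_close:
  assumes F_Lin: "F \<in> Lin r n f" and f_le_m: "f \<le> m"
  shows "log_close (2 * \<beta>) (real (card (addable F))) (N * exp (- (real f * \<delta>)))"
proof (rule log_closeI)
  define x where "x = real f * \<delta>"
  have x_bounds: "0 \<le> x" "x \<le> \<eta>"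
    unfolding x_def using mult_clash_density_le[OF f_le_m] clash_density_nonneg by auto
  have "x\<^sup>2 \<le> \<eta>\<^sup>2" using x_bounds by (intro power_mono) auto
  then have "exp (- x - 2 * \<beta>) \<le> exp (- x - 2 * x\<^sup>2)"
    using total_clash_density_sq_le_step_error by simp
  also have "\<dots> \<le> 1 - x" using x_bounds total_clash_density_bounds by (intro exp_le_one_minus) auto
  finally have "N * exp (- x - 2 * \<beta>) \<le> N * (1 - x)" using N_pos by simp
  also have "\<dots> \<le> real (card (addable F))" unfolding x_def by (rule card_addable_ge[OF F_Lin])
  finally show "N * exp (- (real f * \<delta>)) * exp (- (2 * \<beta>)) \<le> real (card (addable F))"
    by (simp add: x_def mult.assoc flip: exp_add)
  have "1 - x + \<beta> \<le> exp (- x + 2 * \<beta>)"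
    using exp_ge_add_one_self[of "- x + 2 * \<beta>"] step_error_bounds(1) by linarith
  then have "N * (1 - x + \<beta>) \<le> N * exp (- x + 2 * \<beta>)" using N_pos by simp
  then have "real (card (addable F)) \<le> N * exp (- x + 2 * \<beta>)"
    using card_addable_le_step_error[OF assms] unfolding x_def by linarith
  then show "real (card (addable F)) \<le> N * exp (- (real f * \<delta>)) * exp (2 * \<beta>)"
    by (simp add: x_def mult.assoc flip: exp_add)
qed (simp add: N_pos)

lemma num_ext_insert_close:
  assumes F_Lin: "F \<in> Lin r n f" and g_addable: "g \<in> addable F" and f_less_m: "f < m"
  shows "log_close (34 * \<beta>) (N * num_ext m (insert g F))
    (exp (real f * \<delta>) * (real (m - f) * num_ext m F))"
proof -
  let ?A = "num_ext m F" and ?A\<^sub>g = "num_ext m (insert g F)"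
  obtain M where m_eq_Suc: "m = Suc M" "M < m" "f \<le> M" using f_less_m by (cases m) auto
  define \<kappa> where "\<kappa> = (1 - real (M - f) * \<delta>) * num_ext M F"
  have close: "log_close (16 * \<beta>) (num_ext m (insert h F)) \<kappa>" if "h \<in> addable F" for h
    using num_ext_Suc_insert_close[OF F_Lin that m_eq_Suc(2,3)]
    by (simp only: \<kappa>_def flip: m_eq_Suc(1))
  have "real M * \<delta> \<le> \<eta>" "real (M - f) * \<delta> \<le> \<eta>"
    by (rule mult_clash_density_le, use m_eq_Suc(2) in simp)+
  then have "real M * \<delta> < 1" "real (M - f) * \<delta> < 1" using total_clash_density_bounds by linarith+
  then have "0 < \<kappa>" using num_ext_pos[OF F_Lin _ m_eq_Suc(3)] by (simp add: \<kappa>_def)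
  have "log_close (16 * \<beta>) (real (m - f) * ?A) (real (card (addable F)) * \<kappa>)"
    unfolding sum_num_ext_insert[OF F_Lin, symmetric]
    using g_addable finite_addable \<open>0 < \<kappa>\<close> close by (intro log_close_sum) auto
  then have sum_close: "log_close (16 * \<beta>) (real (card (addable F)) * \<kappa>) (real (m - f) * ?A)"
    by (rule log_close_sym)
  have "log_close (2 * \<beta>) (?A\<^sub>g * (N * exp (- (real f * \<delta>)))) (?A\<^sub>g * real (card (addable F)))"
    using card_addable_close[OF F_Lin less_imp_le[OF f_less_m]]
    by (intro log_close_mult_left) (rule log_close_sym)
  also have "?A\<^sub>g * real (card (addable F)) = real (card (addable F)) * ?A\<^sub>g"
    by (rule mult.commute)
  also have "log_close (16 * \<beta>) \<dots> (real (card (addable F)) * \<kappa>)"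
    by (rule log_close_mult_left[OF close[OF g_addable]])
  also note sum_close
  finally have "log_close (34 * \<beta>) (?A\<^sub>g * (N * exp (- (real f * \<delta>)))) (real (m - f) * ?A)"
    by simp
  then have "log_close (34 * \<beta>) (exp (real f * \<delta>) * (?A\<^sub>g * (N * exp (- (real f * \<delta>)))))
      (exp (real f * \<delta>) * (real (m - f) * ?A))"
    by (rule log_close_mult_left)
  moreover have "exp (real f * \<delta>) * (?A\<^sub>g * (N * exp (- (real f * \<delta>)))) = N * ?A\<^sub>g"
    by (simp add: exp_minus)
  ultimately show ?thesis by simp
qed

end

section \<open>Adding the edges one by one\<close>

definition error_scale :: "nat \<Rightarrow> nat \<Rightarrow> nat \<Rightarrow> nat \<Rightarrow> real" where
  "error_scale n r m k = real r ^ 4 * real k / real n ^ 2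
    + min (real r ^ 6 * real m ^ 2 * real k / real n ^ 3)
        (real r ^ 5 * real m * real k / real n ^ 2)"

lemma error_scale_nonneg: "0 \<le> error_scale n r m k"
  by (simp add: error_scale_def)

context sparse_rgraphs_edges
begin

lemma num_ext_close:
  assumes "F \<in> Lin r n f" and "f \<le> m"
  shows "log_close (34 * \<beta> * real f) (N ^ f * num_ext m F)
    (exp (\<delta> * (real f * (real f - 1) / 2)) * (ffall (real m) f * num_ext m {}))"
  using assms
proof (induction f arbitrary: F)
  case 0
  then have "F = {}" by (simp add: Lin_0)
  then show ?case by (simp add: log_close_def ffall_def)
next
  case (Suc f)
  let ?e = "exp (real f * \<delta>)" and ?E = "exp (\<delta> * (real f * (real f - 1) / 2))"
  obtain g where g_in_F: "g \<in> F" using LinD(3)[OF Suc.prems(1)] by fastforce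
  let ?A = "num_ext m (F - {g})"
  have Diff_Lin: "F - {g} \<in> Lin r n f"
    using Lin_subset[OF Suc.prems(1), of "F - {g}"] LinD(3)[OF Suc.prems(1)] g_in_F by simp
  have "g \<in> addable (F - {g})"
    using g_in_F by (intro addable_if_mem_Diff[OF Suc.prems(1)]) auto
  then have "log_close (34 * \<beta>) (N * num_ext m (insert g (F - {g}))) (?e * (real (m - f) * ?A))"
    by (rule num_ext_insert_close[OF Diff_Lin]) (use Suc.prems(2) in simp)
  then have "log_close (34 * \<beta>) (N ^ f * (N * num_ext m F)) (N ^ f * (?e * (real (m - f) * ?A)))"
    unfolding insert_Diff[OF g_in_F] by (rule log_close_mult_left)
  also have "N ^ f * (?e * (real (m - f) * ?A)) = ?e * real (m - f) * (N ^ f * ?A)" by simp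
  also have "log_close (34 * \<beta> * real f) \<dots>
      (?e * real (m - f) * (?E * (ffall (real m) f * num_ext m {})))"
    using Suc.IH[OF Diff_Lin] Suc.prems(2) by (intro log_close_mult_left) simp
  also have "?e * real (m - f) * (?E * (ffall (real m) f * num_ext m {}))
      = ?e * ?E * (ffall (real m) (Suc f) * num_ext m {})"
    using Suc.prems(2) by (simp add: ffall_def of_nat_diff)
  also have "?e * ?E = exp (\<delta> * (real (Suc f) * (real (Suc f) - 1) / 2))"
    by (simp add: field_simps flip: exp_add)
  finally show ?case by (simp add: algebra_simps)
qed

lemma prob_contained_close:
  assumes F_Lin: "F \<in> Lin r n k" and k_le_m: "k \<le> m"
  shows "log_close (34 * \<beta> * real k) (prob_contained r n m F)
    (ffall (real m) k / N ^ k * exp (\<delta> * (real k * (real k - 1) / 2)))"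
proof -
  let ?E = "exp (\<delta> * (real k * (real k - 1) / 2))"
  have "0 < num_ext m {}"
    using m_clash_density_le by (intro num_ext_pos[where f = 0]) (simp_all add: Lin_0)
  moreover have "prob_contained r n m F = num_ext m F / num_ext m {}"
    by (simp add: prob_contained_def extensions_def)
  moreover have "log_close (34 * \<beta> * real k) (1 / (N ^ k * num_ext m {}) * (N ^ k * num_ext m F))
      (1 / (N ^ k * num_ext m {}) * (?E * (ffall (real m) k * num_ext m {})))"
    by (rule log_close_mult_left[OF num_ext_close[OF F_Lin k_le_m]])
  ultimately show ?thesis using N_pos by (simp add: mult_ac)
qed

lemma step_error_le:
  "\<beta> \<le> 3 * min (real r ^ 6 * real m ^ 2 / real n ^ 3) (real r ^ 5 * real m / real n ^ 2)"
proof -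
  have "\<beta> \<le> 3 * (real r ^ 6 * real m ^ 2 / real n ^ 3)"
    using step_error_bounds(3) by (simp add: triple_density_def mult_ac)
  moreover have "\<beta> \<le> real r ^ 5 * real m / real n ^ 2"
  proof -
    have "\<delta> \<le> real r ^ 4 / (2 * real n ^ 2)" by (rule clash_density_le)
    also have "\<dots> \<le> real r ^ 5 / real n ^ 2"
      using three_le_r nine_le_n by (intro frac_le power_increasing) auto
    finally have "\<eta> \<le> real m * (real r ^ 5 / real n ^ 2)"
      unfolding total_clash_density_def by (intro mult_left_mono) auto
    then show ?thesis using step_error_bounds(2) by (simp add: mult.commute)
  qed
  moreover have "0 \<le> real r ^ 5 * real m / real n ^ 2" by simp
  ultimately show ?thesis by linarith
qed

lemma mult_clash_density_div_n_le: "real m * (\<delta> / real n) \<le> \<beta>"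
proof -
  have "real m * (\<delta> / real n) \<le> \<eta>"
    unfolding total_clash_density_def
    using nine_le_n clash_density_nonneg mult_left_mono[of 1 "real n" \<delta>]
    by (intro mult_left_mono) (auto simp: divide_le_eq)
  moreover have "real m * (\<delta> / real n) \<le> real m ^ 2 * \<rho>"
  proof (intro mult_mono)
    have "\<delta> / real n \<le> real r ^ 4 / (2 * real n ^ 2) / real n"
      by (intro divide_right_mono clash_density_le) simp
    also have "\<dots> = real r ^ 4 / (2 * real n ^ 3)"
      by (simp add: power2_eq_square power3_eq_cube mult_ac)
    also have "\<dots> \<le> 3 * real r ^ 6 / real n ^ 3"
    proof (intro frac_le)
      have "real r ^ 4 \<le> real r ^ 6" using three_le_r by (intro power_increasing) auto
      also have "\<dots> \<le> 3 * real r ^ 6" by simp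
      finally show "real r ^ 4 \<le> 3 * real r ^ 6" .
    qed (use nine_le_n in auto)
    finally show "\<delta> / real n \<le> \<rho>" unfolding triple_density_def .
    show "real m \<le> real m ^ 2"
      using of_nat_mono[where 'a = real, OF le_square[of m]] by (simp add: power2_eq_square)
  qed (use clash_density_nonneg in auto)
  ultimately show ?thesis by (simp add: step_error_def)
qed

lemma exponent_approx:
  assumes k_le_m: "k \<le> m"
  shows "\<bar>\<delta> * (real k * (real k - 1) / 2) - ffall (real r) 2 ^ 2 * real k ^ 2 / (4 * real n ^ 2)\<bar>
    \<le> \<beta> * real k + real r ^ 4 * real k / real n ^ 2"
proof -
  let ?s = "ffall (real r) 2 ^ 2 * real k ^ 2 / (4 * real n ^ 2)"
  define u where "u = real k * (\<delta> / real n) * real k / 2"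
  define v where "v = \<delta> * real k / 2"
  have ffall: "ffall (real r) 2 ^ 2 / (2 * real n ^ 2) = \<delta> - \<delta> / real n"
    using nine_le_n
    by (simp add: ffall_def clash_density_def numeral_2_eq_2 divide_simps) (simp add: algebra_simps)
  have "?s = ffall (real r) 2 ^ 2 / (2 * real n ^ 2) * real k ^ 2 / 2" by simp
  then have diff: "\<delta> * (real k * (real k - 1) / 2) - ?s = u - v"
    unfolding ffall by (simp add: u_def v_def power2_eq_square algebra_simps diff_divide_distrib)
  have "real k * (\<delta> / real n) \<le> real m * (\<delta> / real n)"
    using k_le_m clash_density_nonneg by (intro mult_right_mono) auto
  also have "\<dots> \<le> \<beta>" by (rule mult_clash_density_div_n_le)
  finally have "2 * u \<le> \<beta> * real k"
    unfolding u_def using mult_right_mono[of "real k * (\<delta> / real n)" \<beta> "real k"] by simp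
  moreover have "4 * v \<le> real r ^ 4 * real k / real n ^ 2"
    using mult_right_mono[OF clash_density_le, of "2 * real k"] by (simp add: v_def mult_ac)
  moreover have "0 \<le> u" "0 \<le> v" unfolding u_def v_def using clash_density_nonneg by simp_all
  ultimately show ?thesis unfolding diff by linarith
qed

lemma prob_contained_approx:
  assumes F_Lin: "F \<in> Lin r n k" and k_le_m: "k \<le> m"
  shows "\<exists>x. \<bar>x\<bar> \<le> 105 * error_scale n r m k \<and>
    prob_contained r n m F = ffall (real m) k / real (n choose r) ^ k
      * exp (ffall (real r) 2 ^ 2 * real k ^ 2 / (4 * real n ^ 2) + x)"
proof -
  let ?s = "ffall (real r) 2 ^ 2 * real k ^ 2 / (4 * real n ^ 2)"
  obtain x where x_close: "\<bar>x\<bar> \<le> 34 * \<beta> * real k"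
    "prob_contained r n m F
      = ffall (real m) k / N ^ k * exp (\<delta> * (real k * (real k - 1) / 2)) * exp x"
    using prob_contained_close[OF assms] by (auto simp: log_close_def)
  define y where "y = \<delta> * (real k * (real k - 1) / 2) - ?s + x"
  have "prob_contained r n m F = ffall (real m) k / real (n choose r) ^ k * exp (?s + y)"
    using x_close(2) by (simp add: y_def N_def exp_add)
  moreover have "\<bar>y\<bar> \<le> 105 * error_scale n r m k"
  proof -
    define t\<^sub>1 where "t\<^sub>1 = real r ^ 4 * real k / real n ^ 2"
    define t\<^sub>2 where "t\<^sub>2 = min (real r ^ 6 * real m ^ 2 * real k / real n ^ 3)
      (real r ^ 5 * real m * real k / real n ^ 2)"
    have "\<beta> * real k
      \<le> 3 * (min (real r ^ 6 * real m ^ 2 / real n ^ 3) (real r ^ 5 * real m / real n ^ 2) * real k)"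
      unfolding mult.assoc[of 3, symmetric] by (intro mult_right_mono step_error_le) simp
    then have "\<beta> * real k \<le> 3 * t\<^sub>2" by (simp add: t\<^sub>2_def min_mult_distrib_right)
    moreover have "\<bar>y\<bar> \<le> 35 * (\<beta> * real k) + t\<^sub>1"
      using x_close(1) exponent_approx[OF k_le_m] unfolding y_def t\<^sub>1_def by linarith
    moreover have "error_scale n r m k = t\<^sub>1 + t\<^sub>2" "0 \<le> t\<^sub>1"
      by (simp_all add: error_scale_def t\<^sub>1_def t\<^sub>2_def)
    ultimately show ?thesis by linarith
  qed
  ultimately show ?thesis by blast
qed

end

lemma sparse_rgraphs_edges_if_small:
  assumes three_le_r: "3 \<le> r" and one_le_m: "1 \<le> m"
    and small: "real m \<le> 1/16 * (real n powr (3/2) / real r ^ 3)"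
  shows "sparse_rgraphs_edges n r m"
proof -
  define s where "s = sqrt (real n)"
  have s_sqrt: "0 \<le> s" "s\<^sup>2 = real n" by (simp_all add: s_def)
  have "real n powr (3/2) = s ^ 3"
    using powr_powr[of "real n" "1/2" 3]
    by (cases "n = 0") (simp_all add: s_def powr_half_sqrt flip: powr_numeral)
  then have m_small: "16 * real m * real r ^ 3 \<le> s ^ 3"
    using small three_le_r by (simp add: field_simps)
  have "real r ^ 3 \<le> 16 * real m * real r ^ 3"
    using one_le_m by (intro mult_right_mono[of 1 "16 * real m", simplified]) auto
  then have r_le_s: "real r \<le> s"
    using m_small s_sqrt(1)
    by (intro power_le_imp_le_base[of "real r" 2 s]) (simp_all add: numeral_3_eq_3)
  then have "real r ^ 2 \<le> real n" using s_sqrt(2) power_mono[OF r_le_s, of 2] by simp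
  then have "r\<^sup>2 \<le> n" by (metis of_nat_le_iff of_nat_power)
  then interpret sparse_rgraphs n r by unfold_locales (use three_le_r in simp_all)
  have "0 < s" using r_le_s three_le_r by linarith
  have "real m * \<delta> \<le> real m * (real r ^ 4 / (2 * real n ^ 2))"
    using clash_density_le by (rule mult_left_mono) simp
  also have "\<dots> = (16 * real m * real r ^ 3) * real r / (32 * s ^ 4)"
    by (simp add: power4_eq_xxxx power3_eq_cube power2_eq_square flip: s_sqrt(2))
  also have "\<dots> \<le> s ^ 3 * s / (32 * s ^ 4)"
    using m_small r_le_s \<open>0 < s\<close> by (intro divide_right_mono mult_mono) auto
  also have "\<dots> = 1/32" using \<open>0 < s\<close> by (simp add: power4_eq_xxxx power3_eq_cube)
  finally show ?thesis by unfold_locales simp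
qed

lemma prob_contained_eq_0:
  assumes "m < card F"
  shows "prob_contained r n m F = 0"
proof -
  have "{H \<in> Lin r n m. F \<subseteq> H} = {}"
    using card_le_if_subset_Lin[of _ r n m F] assms by auto
  then show ?thesis unfolding prob_contained_def by (simp only: card.empty)
qed

lemma ex_prob_contained_eq_exp:
  assumes three_le_r: "3 \<le> r" and small: "real m \<le> 1/16 * (real n powr (3/2) / real r ^ 3)"
    and F_Lin: "F \<in> Lin r n k"
  shows "\<exists>x. \<bar>x\<bar> \<le> 105 * error_scale n r m k \<and>
    prob_contained r n m F = ffall (real m) k / real (n choose r) ^ k
      * exp (ffall (real r) 2 ^ 2 * real k ^ 2 / (4 * real n ^ 2) + x)"
proof -
  consider (too_few) "m < k" | (no_edges) "m = 0" "k = 0" | (enough) "1 \<le> m" "k \<le> m" by linarith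
  then show ?thesis
  proof cases
    case too_few
    then have "prob_contained r n m F = 0"
      using LinD(3)[OF F_Lin] by (intro prob_contained_eq_0) simp
    moreover have "ffall (real m) k = 0"
      unfolding ffall_def using too_few by (intro prod_zero) auto
    ultimately show ?thesis using error_scale_nonneg by (intro exI[of _ 0]) simp
  next
    case no_edges
    then have "F = {}" using F_Lin by (simp add: Lin_0)
    then show ?thesis using no_edges error_scale_nonneg
      by (intro exI[of _ 0]) (simp add: prob_contained_def Lin_0 ffall_def)
  next
    case enough
    interpret sparse_rgraphs_edges n r m
      using three_le_r enough(1) small by (rule sparse_rgraphs_edges_if_small)
    show ?thesis by (rule prob_contained_approx[OF F_Lin enough(2)])
  qed
qed

theorem theorem1p5:
  fixes r m k :: "nat \<Rightarrow> nat" and K :: "nat \<Rightarrow> nat set set"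
  assumes r3: "\<forall>\<^sub>F n in sequentially. r n \<ge> 3"
    and m_small: "(\<lambda>n. real (m n)) \<in> o(\<lambda>n. real n powr (3/2) / real (r n) ^ 3)"
    and k_small: "(\<lambda>n. real (k n) * real (r n) ^ 6 * real (m n) ^ 2) \<in> o(\<lambda>n. real n ^ 3)"
    and K: "\<forall>\<^sub>F n in sequentially. K n \<in> Lin (r n) n (k n)"
  shows "\<exists>E :: nat \<Rightarrow> real.
           E \<in> O(\<lambda>n. real (r n) ^ 4 * real (k n) / real n ^ 2
                 + min (real (r n) ^ 6 * real (m n) ^ 2 * real (k n) / real n ^ 3)
                       (real (r n) ^ 5 * real (m n) * real (k n) / real n ^ 2)) \<and>
           (\<forall>\<^sub>F n in sequentially.
              prob_contained (r n) n (m n) (K n) =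
                ffall (real (m n)) (k n) / real (n choose r n) ^ k n
                * exp (ffall (real (r n)) 2 ^ 2 * real (k n) ^ 2 / (4 * real n ^ 2) + E n))"
  unfolding error_scale_def[symmetric]
proof -
  let ?P = "\<lambda>n x. prob_contained (r n) n (m n) (K n)
    = ffall (real (m n)) (k n) / real (n choose r n) ^ k n
      * exp (ffall (real (r n)) 2 ^ 2 * real (k n) ^ 2 / (4 * real n ^ 2) + x)"
  let ?g = "\<lambda>n. error_scale n (r n) (m n) (k n)"
  have "\<forall>\<^sub>F n in sequentially. real (m n) \<le> 1/16 * (real n powr (3/2) / real (r n) ^ 3)"
    using landau_o.smallD[OF m_small, of "1/16"] by simp
  with r3 K have "\<forall>\<^sub>F n in sequentially. \<exists>x. \<bar>x\<bar> \<le> 105 * ?g n \<and> ?P n x"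
    by eventually_elim (rule ex_prob_contained_eq_exp)
  then obtain E where E: "\<forall>\<^sub>F n in sequentially. \<bar>E n\<bar> \<le> 105 * ?g n \<and> ?P n (E n)"
    unfolding eventually_ex by blast
  then have "E \<in> O(?g)"
    by (intro bigoI[where c = 105]) (auto elim: eventually_mono simp: error_scale_nonneg)
  moreover have "\<forall>\<^sub>F n in sequentially. ?P n (E n)"
    using E by eventually_elim simp
  ultimately show "\<exists>E. E \<in> O(?g) \<and> (\<forall>\<^sub>F n in sequentially. ?P n (E n))" by blast
qed

end
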